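(* Let $T=(V,E)$ be a leafless directed tree with a root, let $1<q<\infty$, let $\lambda$ be the constant sequence defined by $\lambda_v=1$ for each $v\in V$, and assume that the backward shift $B$ is bounded on $\mathbf{L}^q(T,\lambda)$. The operator $B$ is hypercyclic if and only if the tree $T$ has no free ends.
   Context: A directed graph $T=(V,E)$ consists of a countably infinite set $V$ of vertices and a set $E\subseteq V\times V$ of directed edges; it is always assumed locally finite (every vertex has finite indegree and finite outdegree). $T$ is a directed tree if it has no directed circuits (including loops $(v,v)$), its underlying undirected graph is connected, and every vertex has indegree $0$ or $1$. A root is a vertex of indegree $0$ (there is at most one). A leaf is a vertex of outdegree $0$; leafless means having no leaf. If $v$ is not the root, its parent $\operatorname{par}(v)$ is the unique $u$ with $(u,v)\in E$; $\operatorname{par}^n$ denotes the $n$-fold iterate of $\operatorname{par}$, where defined. $\operatorname{Chi}(u)=\{v\in V:\operatorname{par}(v)=u\}$. A vertex $v$ is a descendant of $u$ if $\operatorname{par}^n(v)=u$ for some $n\in\mathbb{N}=\{1,2,\dots\}$. A leafless directed tree has a free end if there exists a vertex such that all of its descendants have outdegree one. $\mathbf{L}^q(T,\lambda)$ is the complex Banach space of functions $f:V\to\mathbb{C}$ with $\|f\|_q=\big(\sum_{v\in V}|f(v)|^q\lambda_v\big)^{1/q}<\infty$. The backward shift $B$ is defined by $(Bf)(u)=\sum_{v\in\operatorname{Chi}(u)}f(v)$ for $u\in V$. A bounded operator $A$ on a Banach space $\mathcal{B}$ is hypercyclic if there is $x\in\mathcal{B}$ such that $\{A^nx: n=0,1,2,\dots\}$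 is dense in $\mathcal{B}$. *)

theory Defs
  imports "HOL-Analysis.Analysis"
begin

section \<open>Directed trees\<close>

definition indegree :: "('a \<times> 'a) set \<Rightarrow> 'a \<Rightarrow> nat" where
  "indegree E v = card {u. (u, v) \<in> E}"

definition outdegree :: "('a \<times> 'a) set \<Rightarrow> 'a \<Rightarrow> nat" where
  "outdegree E v = card {w. (v, w) \<in> E}"

text \<open>Degrees are cardinalities of sets that local finiteness makes finite, so degree \<open>0\<close> really
  means that there is no corresponding edge.\<close>

locale directed_graph =
  fixes V :: "'a set" and E :: "('a \<times> 'a) set"
  assumes countable_V: "countable V"
    and infinite_V: "infinite V"
    and edges: "E \<subseteq> V \<times> V"
    and finite_in: "\<And>v. v \<in> V \<Longrightarrow> finite {u. (u, v) \<in> E}"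
    and finite_out: "\<And>v. v \<in> V \<Longrightarrow> finite {w. (v, w) \<in> E}"

locale directed_tree = directed_graph +
  assumes no_circuits: "acyclic E"
    and connected_undirected: "\<And>u v. u \<in> V \<Longrightarrow> v \<in> V \<Longrightarrow> (u, v) \<in> (E \<union> E\<inverse>)\<^sup>*"
    and indegree_0_or_1: "\<And>v. v \<in> V \<Longrightarrow> indegree E v = 0 \<or> indegree E v = 1"

definition is_root :: "'a set \<Rightarrow> ('a \<times> 'a) set \<Rightarrow> 'a \<Rightarrow> bool" where
  "is_root V E v \<longleftrightarrow> v \<in> V \<and> indegree E v = 0"

definition is_leaf :: "'a set \<Rightarrow> ('a \<times> 'a) set \<Rightarrow> 'a \<Rightarrow> bool" where
  "is_leaf V E v \<longleftrightarrow> v \<in> V \<and> outdegree E v = 0"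

definition leafless :: "'a set \<Rightarrow> ('a \<times> 'a) set \<Rightarrow> bool" where
  "leafless V E \<longleftrightarrow> \<not> (\<exists>v. is_leaf V E v)"

text \<open>The parent is a partial map, undefined (\<open>None\<close>) exactly where there is no unique predecessor;
  in a directed tree this happens only at the root. Its iterates are partial maps as well.\<close>

definition par :: "('a \<times> 'a) set \<Rightarrow> 'a \<Rightarrow> 'a option" where
  "par E v = (if \<exists>!u. (u, v) \<in> E then Some (THE u. (u, v) \<in> E) else None)"

primrec par_iter :: "('a \<times> 'a) set \<Rightarrow> nat \<Rightarrow> 'a \<Rightarrow> 'a option" where
  "par_iter E 0 v = Some v"
| "par_iter E (Suc n) v = Option.bind (par_iter E n v) (par E)"

definition Chi :: "'a set \<Rightarrow> ('a \<times> 'a) set \<Rightarrow> 'a \<Rightarrow> 'a set" where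
  "Chi V E u = {v \<in> V. par E v = Some u}"

definition descendant :: "'a set \<Rightarrow> ('a \<times> 'a) set \<Rightarrow> 'a \<Rightarrow> 'a \<Rightarrow> bool" where
  "descendant V E u v \<longleftrightarrow> v \<in> V \<and> (\<exists>n\<ge>1. par_iter E n v = Some u)"

definition has_free_end :: "'a set \<Rightarrow> ('a \<times> 'a) set \<Rightarrow> bool" where
  "has_free_end V E \<longleftrightarrow> (\<exists>u\<in>V. \<forall>v. descendant V E u v \<longrightarrow> outdegree E v = 1)"

lemma (in directed_tree) Chi_eq: "Chi V E u = {v. (u, v) \<in> E}"
proof -
  have "par E v = Some u \<longleftrightarrow> (u, v) \<in> E" if "v \<in> V" for v
  proof
    assume "par E v = Some u"
    then show "(u, v) \<in> E"
      unfolding par_def by (metis (mono_tags, lifting) option.distinct(1) option.inject theI')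
  next
    assume uv: "(u, v) \<in> E"
    have "indegree E v \<noteq> 0"
      using uv finite_in[OF that] by (auto simp: indegree_def)
    then have "card {w. (w, v) \<in> E} = 1"
      using indegree_0_or_1[OF that] by (simp add: indegree_def)
    then obtain x where x: "{w. (w, v) \<in> E} = {x}"
      by (meson card_1_singletonE)
    then have "\<And>w. (w, v) \<in> E \<longleftrightarrow> w = u"
      using uv by (metis mem_Collect_eq singletonD singletonI)
    then show "par E v = Some u"
      by (simp add: par_def)
  qed
  then show ?thesis
    using edges by (auto simp: Chi_def)
qed


section \<open>The space \<open>L\<^sup>q(T, \<lambda>)\<close> and the backward shift\<close>

text \<open>Functions on \<open>V\<close> are represented by functions on the whole type that vanish off \<open>V\<close>, so that
  equality of functions on \<open>V\<close> is equality in HOL.\<close>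

definition Lq :: "'a set \<Rightarrow> real \<Rightarrow> ('a \<Rightarrow> real) \<Rightarrow> ('a \<Rightarrow> complex) set" where
  "Lq V q lam = {f. (\<forall>v. v \<notin> V \<longrightarrow> f v = 0) \<and> (\<lambda>v. cmod (f v) powr q * lam v) summable_on V}"

definition Lq_norm :: "'a set \<Rightarrow> real \<Rightarrow> ('a \<Rightarrow> real) \<Rightarrow> ('a \<Rightarrow> complex) \<Rightarrow> real" where
  "Lq_norm V q lam f = (\<Sum>\<^sub>\<infinity>v\<in>V. cmod (f v) powr q * lam v) powr (1 / q)"

definition backward_shift ::
  "'a set \<Rightarrow> ('a \<times> 'a) set \<Rightarrow> ('a \<Rightarrow> complex) \<Rightarrow> 'a \<Rightarrow> complex" where
  "backward_shift V E f u = (\<Sum>v\<in>Chi V E u. f v)"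


section \<open>Bounded and hypercyclic operators\<close>

text \<open>A space is given by its carrier \<open>X\<close>, a set of complex-valued functions with pointwise operations,
  and its norm \<open>N\<close>.\<close>

definition bounded_operator_on ::
  "('a \<Rightarrow> complex) set \<Rightarrow> (('a \<Rightarrow> complex) \<Rightarrow> real) \<Rightarrow> (('a \<Rightarrow> complex) \<Rightarrow> 'a \<Rightarrow> complex) \<Rightarrow> bool"
where
  "bounded_operator_on X N A \<longleftrightarrow>
     (\<forall>f\<in>X. A f \<in> X) \<and>
     (\<forall>f\<in>X. \<forall>g\<in>X. A (\<lambda>v. f v + g v) = (\<lambda>v. A f v + A g v)) \<and>
     (\<forall>c. \<forall>f\<in>X. A (\<lambda>v. c * f v) = (\<lambda>v. c * A f v)) \<and>
     (\<exists>C. \<forall>f\<in>X. N (A f) \<le> C * N f)"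

definition dense_in ::
  "('a \<Rightarrow> complex) set \<Rightarrow> (('a \<Rightarrow> complex) \<Rightarrow> real) \<Rightarrow> ('a \<Rightarrow> complex) set \<Rightarrow> bool" where
  "dense_in X N D \<longleftrightarrow> D \<subseteq> X \<and> (\<forall>g\<in>X. \<forall>e>0. \<exists>f\<in>D. N (\<lambda>v. f v - g v) < e)"

definition hypercyclic_on ::
  "('a \<Rightarrow> complex) set \<Rightarrow> (('a \<Rightarrow> complex) \<Rightarrow> real) \<Rightarrow> (('a \<Rightarrow> complex) \<Rightarrow> 'a \<Rightarrow> complex) \<Rightarrow> bool"
where
  "hypercyclic_on X N A \<longleftrightarrow> (\<exists>f\<in>X. dense_in X N {(A ^^ n) f | n. True})"

end

theory Submission
  imports Defs
begin

text \<open>Below a free end, the value at a fixed vertex of every iterate \<open>B\<^sup>n f\<close> is a single value of \<open>f\<close>,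
  hence bounded by the norm of \<open>f\<close>, and the orbit cannot be dense. Without free ends every vertex has
  arbitrarily large generations of descendants. Distributing a value \<open>c\<close> evenly over a generation of
  size \<open>N\<close> multiplies its contribution \<open>\<bar>c\<bar>\<^sup>q\<close> to the \<open>q\<close>-th power of the norm by \<open>N\<close> to the power
  \<open>1 - q < 0\<close>, so finitely supported functions \<open>g\<close> have arbitrarily small preimages under large powers
  of \<open>B\<close>. A hypercyclic vector is glued from such preimages of a dense sequence \<open>g\<^sub>k\<close> under \<open>B\<close> to
  the powers \<open>n\<^sub>k\<close>, supported in the disjoint depth ranges from \<open>n\<^sub>k\<close> (inclusive) to \<open>n\<^bsub>k+1\<^esub>\<close> (exclusive): the
  earlier pieces do not contribute to that iterate because the tree has a root, and the later ones
  are small compared with its norm.\<close>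

section \<open>Descendants in a rooted leafless tree\<close>

locale rooted_leafless_tree = directed_tree +
  fixes r :: 'a
  assumes root: "is_root V E r"
    and leafless: "leafless V E"
begin

section \<open>Unique ancestors, directed paths from the root, and depth\<close>

lemma edge_in_V: "(u, v) \<in> E \<Longrightarrow> u \<in> V \<and> v \<in> V"
  using edges by auto

lemma unique_parent:
  assumes "(u, v) \<in> E" "(u', v) \<in> E"
  shows "u = u'"
proof -
  have v: "v \<in> V"
    using assms edge_in_V by blast
  have "card {w. (w, v) \<in> E} \<le> 1"
    using indegree_0_or_1[OF v] by (auto simp: indegree_def)
  then show ?thesis
    using assms finite_in[OF v] by (auto simp: card_le_Suc0_iff_eq)
qed

lemma no_edge_to_root: "(u, r) \<notin> E"
  using root finite_in[of r] by (auto simp: is_root_def indegree_def)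

lemma root_in_V: "r \<in> V"
  using root by (simp add: is_root_def)

text \<open>Uniqueness of parents, applied step by step. It makes the \<open>n\<close>-th
  generations below distinct vertices disjoint, so that sums over them can be split.\<close>

lemma unique_ancestor: "(u, v) \<in> E ^^ n \<Longrightarrow> (u', v) \<in> E ^^ n \<Longrightarrow> u = u'"
proof (induction n arbitrary: v)
  case (Suc n)
  then show ?case
    by (metis relpow_Suc_E unique_parent)
qed auto

lemma relpow_in_V: "(u, v) \<in> E ^^ n \<Longrightarrow> u \<in> V \<Longrightarrow> v \<in> V"
  by (cases n) (auto dest: edge_in_V)

text \<open>Induction along an undirected path: a forward edge prolongs the directed path, and a
  backward edge can only retrace its last edge, because parents are unique and no edge enters
  \<open>r\<close>.\<close>

lemma reachable_from_root:
  assumes "v \<in> V"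
  shows "(r, v) \<in> E\<^sup>*"
proof -
  have "(r, v) \<in> (E \<union> E\<inverse>)\<^sup>*"
    using connected_undirected root_in_V assms by blast
  then show ?thesis
  proof (induction rule: rtrancl_induct)
    case (step y z)
    then consider "(y, z) \<in> E" | "(z, y) \<in> E"
      by blast
    then show ?case
    proof cases
      case 2
      from step.IH show ?thesis
      proof (cases rule: rtranclE)
        case base
        then show ?thesis using 2 no_edge_to_root by blast
      next
        case (step w)
        then show ?thesis using 2 unique_parent by blast
      qed
    qed (use step in auto)
  qed auto
qed

lemma distance_from_root_unique: "(r, v) \<in> E ^^ m \<Longrightarrow> (r, v) \<in> E ^^ n \<Longrightarrow> m = n"
proof (induction m arbitrary: n v)
  case 0
  then show ?case
    using no_edge_to_root by (cases n) auto
next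
  case (Suc m)
  from Suc.prems(1) obtain w where w: "(r, w) \<in> E ^^ m" "(w, v) \<in> E"
    by auto
  show ?case
  proof (cases n)
    case 0
    then show ?thesis
      using w Suc.prems(2) no_edge_to_root by auto
  next
    case (Suc n')
    then show ?thesis
      using w Suc.prems(2) Suc.IH unique_parent by (metis relpow_Suc_E)
  qed
qed

text \<open>Well defined on \<open>V\<close> by \<open>reachable_from_root\<close> and
  \<open>distance_from_root_unique\<close>; outside \<open>V\<close> the value is
  unspecified.\<close>

definition depth :: "'a \<Rightarrow> nat" where
  "depth v = (THE n. (r, v) \<in> E ^^ n)"

lemma depth_eqI: "(r, v) \<in> E ^^ n \<Longrightarrow> depth v = n"
  unfolding depth_def using distance_from_root_unique by blast

lemma depth_relpow:
  assumes "(u, v) \<in> E ^^ n" "u \<in> V"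
  shows "depth v = depth u + n"
proof -
  obtain m where m: "(r, u) \<in> E ^^ m"
    using reachable_from_root[OF \<open>u \<in> V\<close>] rtrancl_imp_relpow by blast
  then have "(r, v) \<in> E ^^ (m + n)"
    using assms relpow_add by fastforce
  then show ?thesis
    using depth_eqI m by simp
qed

text \<open>Separating the first edge makes the path have length at least one and puts its vertices
  into \<open>V\<close>.\<close>

lemma descendantI:
  assumes "(u, w) \<in> E" "(w, v) \<in> E ^^ n"
  shows "descendant V E u v"
proof -
  have *: "(x, v) \<in> E ^^ n \<Longrightarrow> v \<in> V \<Longrightarrow> par_iter E n v = Some x" for x n
  proof (induction n arbitrary: x)
    case (Suc n)
    then obtain y where y: "(x, y) \<in> E" "(y, v) \<in> E ^^ n"
      by (meson relpow_Suc_D2)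
    then have "par E y = Some x"
      unfolding par_def using unique_parent by auto
    with y Suc show ?case
      by simp
  qed auto
  have "v \<in> V"
    using assms edge_in_V relpow_in_V by blast
  moreover have "(u, v) \<in> E ^^ Suc n"
    using assms relpow_Suc_I2 by fast
  ultimately show ?thesis
    unfolding descendant_def using * by (metis le_add1 plus_1_eq_Suc)
qed

lemma descendantD:
  assumes "descendant V E u v"
  obtains n where "(u, v) \<in> E ^^ n" "n \<ge> 1"
proof -
  have *: "par_iter E n v = Some x \<Longrightarrow> (x, v) \<in> E ^^ n" for x n
  proof (induction n arbitrary: x)
    case (Suc n)
    then obtain y where y: "par_iter E n v = Some y" "par E y = Some x"
      by (auto simp: bind_eq_Some_conv)
    then have "(x, y) \<in> E"
      unfolding par_def by (metis (mono_tags, lifting) option.distinct(1) option.inject theI')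
    with y Suc show ?case
      using relpow_Suc_I2 by fast
  qed auto
  with assms that show ?thesis
    unfolding descendant_def by blast
qed

section \<open>Sizes of the generations of descendants\<close>

lemma outdegree_eq_card_image: "outdegree E v = card (E `` {v})"
  by (simp add: outdegree_def Image_singleton)

lemma outdegree_pos: "v \<in> V \<Longrightarrow> outdegree E v \<ge> 1"
  using leafless by (force simp: leafless_def is_leaf_def)

lemma finite_image: "finite (E `` {v})"
proof (cases "v \<in> V")
  case True
  then show ?thesis
    using finite_out by (simp add: Image_singleton)
next
  case False
  then have "E `` {v} = {}"
    using edge_in_V by blast
  then show ?thesis
    by simp
qed

abbreviation gen :: "nat \<Rightarrow> 'a \<Rightarrow> 'a set" where
  "gen n u \<equiv> (E ^^ n) `` {u}"

lemma gen_Suc: "gen (Suc n) u = (\<Union>w\<in>gen n u. E `` {w})"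
  by auto

text \<open>Splitting at the top matches the iterates of the shift, whose outermost application sums
  over the children of \<open>u\<close>; \<open>gen_Suc\<close> splits at the bottom and serves for
  counting.\<close>

lemma gen_Suc': "gen (Suc n) u = (\<Union>w\<in>E `` {u}. gen n w)"
  by (auto simp del: relpow.simps intro: relpow_Suc_I2 dest: relpow_Suc_D2)

lemma finite_gen: "finite (gen n u)"
proof (induction n)
  case (Suc n)
  then show ?case
    unfolding gen_Suc using finite_image by blast
qed (auto simp: Image_singleton)

lemma card_gen_Suc: "card (gen (Suc n) u) = (\<Sum>w\<in>gen n u. outdegree E w)"
  unfolding gen_Suc outdegree_eq_card_image
  using finite_gen finite_image unique_parent by (intro card_UN_disjoint) blast+

lemma card_gen_mono:
  assumes "u \<in> V"
  shows "mono (\<lambda>n. card (gen n u))"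
proof (rule incseq_SucI)
  fix n
  have "(\<Sum>w\<in>gen n u. 1) \<le> (\<Sum>w\<in>gen n u. outdegree E w)"
    using outdegree_pos relpow_in_V assms by (intro sum_mono) blast
  then show "card (gen n u) \<le> card (gen (Suc n) u)"
    unfolding card_gen_Suc by simp
qed

lemma card_gen_pos: "u \<in> V \<Longrightarrow> card (gen n u) \<ge> 1"
  using monoD[OF card_gen_mono, of u 0 n] by (simp add: Image_singleton)

text \<open>Below any vertex of a generation some descendant branches, and the generation after that
  descendant is strictly larger than its own; in between, sizes never drop.\<close>

lemma card_gen_unbounded:
  assumes "\<not> has_free_end V E" "u \<in> V"
  shows "\<exists>n. card (gen n u) \<ge> m"
proof (induction m)
  case (Suc m)
  then obtain n where n: "card (gen n u) \<ge> m"
    by blast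
  have "gen n u \<noteq> {}"
    using card_gen_pos[OF \<open>u \<in> V\<close>, of n] by (metis card.empty not_one_le_zero)
  then obtain w where w: "(u, w) \<in> E ^^ n"
    by blast
  then have "w \<in> V"
    using assms relpow_in_V by blast
  then obtain v where v: "descendant V E w v" "outdegree E v \<noteq> 1"
    using assms unfolding has_free_end_def by blast
  then obtain k where "(w, v) \<in> E ^^ k"
    using descendantD by blast
  with w have uv: "v \<in> gen (n + k) u"
    using relpow_add by fastforce
  have "v \<in> V"
    using v by (simp add: descendant_def)
  have "(\<Sum>w\<in>gen (n + k) u. 1) < (\<Sum>w\<in>gen (n + k) u. outdegree E w)"
  proof (rule sum_strict_mono_ex1)
    show "\<forall>x\<in>gen (n + k) u. 1 \<le> outdegree E x"
      using outdegree_pos relpow_in_V assms by blast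
    show "\<exists>a\<in>gen (n + k) u. 1 < outdegree E a"
      using v uv outdegree_pos[OF \<open>v \<in> V\<close>] by (intro bexI[of _ v]) auto
  qed (rule finite_gen)
  then have "card (gen (n + k) u) < card (gen (Suc (n + k)) u)"
    unfolding card_gen_Suc by simp
  moreover have "card (gen n u) \<le> card (gen (n + k) u)"
    using monoD[OF card_gen_mono[OF \<open>u \<in> V\<close>]] by simp
  ultimately show ?case
    using n by (intro exI[of _ "Suc (n + k)"]) linarith
qed auto

lemma card_gen_at_top:
  assumes "\<not> has_free_end V E" "u \<in> V"
  shows "filterlim (\<lambda>n. real (card (gen n u))) at_top sequentially"
proof -
  have "filterlim (\<lambda>n. card (gen n u)) at_top sequentially"
    unfolding filterlim_at_top eventually_sequentially
    using card_gen_unbounded[OF assms] monoD[OF card_gen_mono[OF assms(2)]]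
    by (meson le_trans)
  then show ?thesis
    by (rule filterlim_compose[OF filterlim_real_sequentially])
qed

section \<open>Iterates of the shift and their right inverses\<close>

lemma backward_shift_funpow:
  "(backward_shift V E ^^ n) f u = (\<Sum>v\<in>gen n u. f v)"
proof (induction n arbitrary: u)
  case (Suc n)
  have "(backward_shift V E ^^ Suc n) f u = (\<Sum>w\<in>E `` {u}. \<Sum>v\<in>gen n w. f v)"
    by (simp add: backward_shift_def Chi_eq Image_singleton Suc)
  also have "\<dots> = (\<Sum>v\<in>gen (Suc n) u. f v)"
    unfolding gen_Suc' using finite_image finite_gen unique_ancestor
    by (intro sum.UNION_disjoint[symmetric]) blast+
  finally show ?case .
qed (auto simp: Image_singleton)

text \<open>The index set of the sum has at most one element.\<close>

definition spread :: "nat \<Rightarrow> ('a \<Rightarrow> complex) \<Rightarrow> 'a \<Rightarrow> complex" where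
  "spread n g v = (\<Sum>u | (u, v) \<in> E ^^ n. g u / of_nat (card (gen n u)))"

lemma spread_gen:
  assumes "(u, v) \<in> E ^^ n"
  shows "spread n g v = g u / of_nat (card (gen n u))"
proof -
  have "{u. (u, v) \<in> E ^^ n} = {u}"
    using assms unique_ancestor by blast
  then show ?thesis
    by (simp add: spread_def)
qed

lemma spread_nonzeroE:
  assumes "spread n g v \<noteq> 0"
  obtains u where "(u, v) \<in> E ^^ n" "g u \<noteq> 0"
  using assms unfolding spread_def by (smt (verit) div_0 mem_Collect_eq sum.neutral)

text \<open>Together with \<open>backward_shift_funpow\<close> this says that
  \<open>spread n\<close> is a right inverse of the \<open>n\<close>-th iterate of the shift, on
  \<open>V\<close>.\<close>

lemma sum_gen_spread:
  assumes "u \<in> V"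
  shows "(\<Sum>v\<in>gen n u. spread n g v) = g u"
proof -
  have "(\<Sum>v\<in>gen n u. spread n g v) = (\<Sum>v\<in>gen n u. g u / of_nat (card (gen n u)))"
    by (intro sum.cong) (auto simp: spread_gen)
  also have "\<dots> = g u"
    using card_gen_pos[OF assms, of n] by simp
  finally show ?thesis .
qed

end


section \<open>The \<open>q\<close>-th power of the norm\<close>

text \<open>The unit weight is built in. Unlike the norm, this quantity is additive over disjoint
  supports.\<close>

definition qmass :: "'a set \<Rightarrow> real \<Rightarrow> ('a \<Rightarrow> complex) \<Rightarrow> real" where
  "qmass V q f = (\<Sum>\<^sub>\<infinity>v\<in>V. cmod (f v) powr q)"

lemma qmass_nonneg: "qmass V q f \<ge> 0"
  unfolding qmass_def by (rule infsum_nonneg) simp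

text \<open>A crude substitute for the Minkowski inequality; the factor \<open>2 powr q\<close> is
  absorbed when tolerances are chosen.\<close>

lemma powr_norm_add_le:
  fixes a b :: "'b::real_normed_vector"
  assumes "q > 0"
  shows "norm (a + b) powr q \<le> 2 powr q * (norm a powr q + norm b powr q)"
proof -
  have "norm (a + b) powr q \<le> (2 * max (norm a) (norm b)) powr q"
    using norm_triangle_ineq[of a b] assms by (intro powr_mono2) auto
  also have "\<dots> = 2 powr q * max (norm a) (norm b) powr q"
    by (simp add: powr_mult)
  also have "\<dots> \<le> 2 powr q * (norm a powr q + norm b powr q)"
    by (auto simp: max_def)
  finally show ?thesis .
qed

locale unit_weight =
  fixes V :: "'a set" and q :: real and lam :: "'a \<Rightarrow> real"
  assumes q: "1 < q"
    and lam: "\<And>v. v \<in> V \<Longrightarrow> lam v = 1"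
begin

lemma Lq_iff:
  "f \<in> Lq V q lam \<longleftrightarrow> (\<forall>v. v \<notin> V \<longrightarrow> f v = 0) \<and> (\<lambda>v. cmod (f v) powr q) summable_on V"
  using summable_on_cong[of V "\<lambda>v. cmod (f v) powr q * lam v" "\<lambda>v. cmod (f v) powr q"] lam
  by (auto simp: Lq_def)

lemma Lq_norm_eq: "Lq_norm V q lam f = qmass V q f powr (1 / q)"
proof -
  have "(\<Sum>\<^sub>\<infinity>v\<in>V. cmod (f v) powr q * lam v) = qmass V q f"
    unfolding qmass_def by (rule infsum_cong) (simp add: lam)
  then show ?thesis
    by (simp add: Lq_norm_def)
qed

lemma qmass_eq: "qmass V q f = Lq_norm V q lam f powr q"
  using q qmass_nonneg[of V q f] by (simp add: Lq_norm_eq powr_powr)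

lemma Lq_norm_less:
  assumes "qmass V q f < e powr q" "e > 0"
  shows "Lq_norm V q lam f < e"
proof -
  have "Lq_norm V q lam f < (e powr q) powr (1 / q)"
    unfolding Lq_norm_eq using assms q qmass_nonneg by (intro powr_less_mono2) auto
  then show ?thesis
    using assms q by (simp add: powr_powr)
qed

lemma Lq_finite_sum_le:
  assumes "f \<in> Lq V q lam" "finite F" "F \<subseteq> V"
  shows "(\<Sum>v\<in>F. cmod (f v) powr q) \<le> qmass V q f"
  unfolding qmass_def using assms Lq_iff by (intro finite_sum_le_infsum) auto

text \<open>A single term is at most the whole sum, so with unit weight point evaluations are
  contractive.\<close>

lemma Lq_norm_ge_value:
  assumes "f \<in> Lq V q lam" "v \<in> V"
  shows "cmod (f v) \<le> Lq_norm V q lam f"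
proof -
  have "(cmod (f v) powr q) powr (1 / q) \<le> qmass V q f powr (1 / q)"
    using Lq_finite_sum_le[of f "{v}"] assms q by (intro powr_mono2) auto
  then show ?thesis
    using q by (simp add: powr_powr Lq_norm_eq)
qed

lemma Lq_boundedI:
  assumes "\<And>v. v \<notin> V \<Longrightarrow> f v = 0"
    and "\<And>F. finite F \<Longrightarrow> F \<subseteq> V \<Longrightarrow> (\<Sum>v\<in>F. cmod (f v) powr q) \<le> M"
  shows "f \<in> Lq V q lam \<and> qmass V q f \<le> M"
proof -
  have "(\<lambda>v. cmod (f v) powr q) summable_on V"
    using assms(2) by (intro nonneg_bdd_above_summable_on bdd_aboveI[of _ M]) auto
  moreover from this have "qmass V q f \<le> M"
    unfolding qmass_def using assms(2) by (intro infsum_le_finite_sums)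
  ultimately show ?thesis
    using assms(1) Lq_iff by blast
qed

lemma Lq_add:
  assumes "f \<in> Lq V q lam" "g \<in> Lq V q lam"
  shows "(\<lambda>v. f v + g v) \<in> Lq V q lam \<and>
    qmass V q (\<lambda>v. f v + g v) \<le> 2 powr q * (qmass V q f + qmass V q g)"
proof (rule Lq_boundedI)
  fix F assume F: "finite F" "F \<subseteq> V"
  have "(\<Sum>v\<in>F. cmod (f v + g v) powr q) \<le> (\<Sum>v\<in>F. 2 powr q * (cmod (f v) powr q + cmod (g v) powr q))"
    using q by (intro sum_mono powr_norm_add_le) auto
  also have "\<dots> = 2 powr q * ((\<Sum>v\<in>F. cmod (f v) powr q) + (\<Sum>v\<in>F. cmod (g v) powr q))"
    by (simp add: sum_distrib_left[symmetric] sum.distrib)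
  also have "\<dots> \<le> 2 powr q * (qmass V q f + qmass V q g)"
    using Lq_finite_sum_le[OF assms(1) F] Lq_finite_sum_le[OF assms(2) F]
    by (intro mult_left_mono) auto
  finally show "(\<Sum>v\<in>F. cmod (f v + g v) powr q) \<le> 2 powr q * (qmass V q f + qmass V q g)" .
qed (use assms Lq_iff in auto)

lemma Lq_finite_support:
  assumes "finite F" "F \<subseteq> V" "\<And>v. v \<notin> F \<Longrightarrow> f v = 0"
  shows "f \<in> Lq V q lam \<and> qmass V q f \<le> (\<Sum>v\<in>F. cmod (f v) powr q)"
proof (rule Lq_boundedI)
  fix F' assume F': "finite F'" "F' \<subseteq> V"
  have "(\<Sum>v\<in>F'. cmod (f v) powr q) = (\<Sum>v\<in>F' \<inter> F. cmod (f v) powr q)"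
    using F' assms(3) by (intro sum.mono_neutral_right) auto
  also have "\<dots> \<le> (\<Sum>v\<in>F. cmod (f v) powr q)"
    using assms by (intro sum_mono2) auto
  finally show "(\<Sum>v\<in>F'. cmod (f v) powr q) \<le> (\<Sum>v\<in>F. cmod (f v) powr q)" .
qed (use assms in auto)

text \<open>On a finite set only finitely many pieces are selected, and the terms of
  \<open>f\<close> there are among the terms of those pieces. This allows infinitely many pieces to
  be glued without a convergent series of functions.\<close>

lemma Lq_piecewise:
  fixes h :: "'i \<Rightarrow> 'a \<Rightarrow> complex"
  assumes h: "\<And>j. j \<in> I \<Longrightarrow> h j \<in> Lq V q lam"
    and M: "\<And>J. finite J \<Longrightarrow> J \<subseteq> I \<Longrightarrow> (\<Sum>j\<in>J. qmass V q (h j)) \<le> M"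
    and f0: "\<And>v. v \<notin> V \<Longrightarrow> f v = 0"
    and f: "\<And>v. v \<in> V \<Longrightarrow> f v \<noteq> 0 \<Longrightarrow> \<exists>j\<in>I. f v = h j v"
  shows "f \<in> Lq V q lam \<and> qmass V q f \<le> M"
proof (rule Lq_boundedI)
  fix F assume F: "finite F" "F \<subseteq> V"
  define F' where "F' = {v\<in>F. f v \<noteq> 0}"
  have F': "finite F'" "F' \<subseteq> V"
    using F by (auto simp: F'_def)
  have "\<forall>v\<in>F'. \<exists>j. j \<in> I \<and> f v = h j v"
    using f F(2) unfolding F'_def by blast
  then obtain i where i: "\<And>v. v \<in> F' \<Longrightarrow> i v \<in> I \<and> f v = h (i v) v"
    by (metis (full_types) bchoice)
  have "(\<Sum>v\<in>F. cmod (f v) powr q) = (\<Sum>v\<in>F'. cmod (f v) powr q)"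
    using F by (intro sum.mono_neutral_right) (auto simp: F'_def)
  also have "\<dots> = (\<Sum>v\<in>F'. cmod (h (i v) v) powr q)"
    using i by (intro sum.cong) auto
  \<comment> \<open>Replacing the selected piece by all pieces selected anywhere on
    \<open>F'\<close> decouples \<open>j\<close> from \<open>v\<close>, so the sums can be
    swapped.\<close>
  also have "\<dots> \<le> (\<Sum>v\<in>F'. \<Sum>j\<in>i ` F'. cmod (h j v) powr q)"
    using F' by (intro sum_mono member_le_sum) auto
  also have "\<dots> = (\<Sum>j\<in>i ` F'. \<Sum>v\<in>F'. cmod (h j v) powr q)"
    by (rule sum.swap)
  also have "\<dots> \<le> (\<Sum>j\<in>i ` F'. qmass V q (h j))"
    using h i F' by (intro sum_mono Lq_finite_sum_le) auto
  also have "\<dots> \<le> M"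
    using i F' by (intro M) auto
  finally show "(\<Sum>v\<in>F. cmod (f v) powr q) \<le> M" .
qed (rule f0)

lemma Lq_countable_dense:
  assumes "countable V"
  obtains G where "countable G" "G \<noteq> {}"
    "\<And>g. g \<in> G \<Longrightarrow> finite {v. g v \<noteq> 0} \<and> {v. g v \<noteq> 0} \<subseteq> V"
    "\<And>f e. f \<in> Lq V q lam \<Longrightarrow> e > 0 \<Longrightarrow>
      \<exists>g\<in>G. (\<lambda>v. g v - f v) \<in> Lq V q lam \<and> qmass V q (\<lambda>v. g v - f v) < e"
proof -
  obtain D :: "complex set" where D: "countable D" "\<And>X. open X \<Longrightarrow> X \<noteq> {} \<Longrightarrow> \<exists>d\<in>D. d \<in> X"
    by (rule countable_dense_setE) blast
  \<comment> \<open>Association lists encode finitely supported functions with values in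
    \<open>D\<close>, so countability is inherited from lists over a countable set.\<close>
  define of_list :: "('a \<times> complex) list \<Rightarrow> 'a \<Rightarrow> complex"
    where "of_list l v = (case map_of l v of None \<Rightarrow> 0 | Some c \<Rightarrow> c)" for l v
  define G where "G = of_list ` lists (V \<times> D)"
  show ?thesis
  proof (rule that[of G])
    show "countable G"
      unfolding G_def using assms D by (intro countable_image countable_lists countable_SIGMA) auto
    show "G \<noteq> {}"
      using lists.Nil[of "V \<times> D"] by (auto simp only: G_def image_is_empty)
    show "finite {v. g v \<noteq> 0} \<and> {v. g v \<noteq> 0} \<subseteq> V" if "g \<in> G" for g
    proof -
      from that obtain l where l: "l \<in> lists (V \<times> D)" "g = of_list l"
        unfolding G_def by (elim imageE)
      have "{v. g v \<noteq> 0} \<subseteq> fst ` set l"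
        unfolding l of_list_def
        by (metis (mono_tags, lifting) map_of_eq_None_iff mem_Collect_eq option.simps(4) subsetI)
      moreover have "fst ` set l \<subseteq> V"
        using l(1) by (fastforce simp: in_lists_conv_set)
      ultimately show ?thesis
        by (meson finite_imageI finite_set finite_subset subset_trans)
    qed
    show "\<exists>g\<in>G. (\<lambda>v. g v - f v) \<in> Lq V q lam \<and> qmass V q (\<lambda>v. g v - f v) < e"
      if f: "f \<in> Lq V q lam" and e: "e > 0" for f e
    proof -
      have "((\<lambda>v. cmod (f v) powr q) has_sum qmass V q f) V"
        using f Lq_iff by (simp add: qmass_def has_sum_infsum)
      then obtain F where F: "finite F" "F \<subseteq> V"
        "dist (\<Sum>v\<in>F. cmod (f v) powr q) (qmass V q f) \<le> e / 4"
        using has_sum_finite_approximation[of "\<lambda>v. cmod (f v) powr q" V "qmass V q f" "e/4"] e by auto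
      \<comment> \<open>Errors below \<open>d\<close> on \<open>F\<close> cost at most
        \<open>e / 4\<close> in total; the \<open>+ 1\<close> keeps \<open>d\<close> positive when
        \<open>F\<close> is empty.\<close>
      define d where "d = (e / (4 * (card F + 1))) powr (1 / q)"
      have d: "d > 0"
        using e by (auto simp: d_def)
      have "\<exists>c\<in>D. cmod (c - f v) < d" for v
        using D(2)[of "ball (f v) d"] d by (auto simp: dist_norm norm_minus_commute)
      then obtain c where c: "\<And>v. c v \<in> D \<and> cmod (c v - f v) < d"
        by metis
      obtain xs where xs: "set xs = F"
        using finite_list[OF F(1)] by blast
      define g where "g = of_list (map (\<lambda>v. (v, c v)) xs)"
      have g: "g v = (if v \<in> F then c v else 0)" for v
        by (simp add: g_def of_list_def map_of_map_restrict restrict_map_def xs)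
      have "g \<in> G"
        unfolding G_def g_def using c xs F by (intro imageI) auto
      moreover have "(\<lambda>v. g v - f v) \<in> Lq V q lam \<and> qmass V q (\<lambda>v. g v - f v) \<le> e / 2"
      proof (rule Lq_boundedI)
        fix F' assume F': "finite F'" "F' \<subseteq> V"
        have "(\<Sum>v\<in>F'. cmod (g v - f v) powr q) \<le> (\<Sum>v\<in>F' \<union> F. cmod (g v - f v) powr q)"
          using F F' by (intro sum_mono2) auto
        also have "\<dots> = (\<Sum>v\<in>F. cmod (g v - f v) powr q) + (\<Sum>v\<in>F' - F. cmod (g v - f v) powr q)"
          using F F' by (subst sum.union_disjoint[symmetric]) (auto simp: Un_commute)
        also have "(\<Sum>v\<in>F' - F. cmod (g v - f v) powr q) = (\<Sum>v\<in>F' - F. cmod (f v) powr q)"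
          by (intro sum.cong) (auto simp: g)
        \<comment> \<open>Off \<open>F\<close> the error is \<open>f\<close> itself, and
          \<open>F\<close> already carries all but \<open>e / 4\<close> of its mass.\<close>
        also have "(\<Sum>v\<in>F' - F. cmod (f v) powr q) \<le> e / 4"
        proof -
          have "(\<Sum>v\<in>F. cmod (f v) powr q) + (\<Sum>v\<in>F' - F. cmod (f v) powr q)
            = (\<Sum>v\<in>F' \<union> F. cmod (f v) powr q)"
            using F F' by (subst sum.union_disjoint[symmetric]) (auto simp: Un_commute)
          also have "\<dots> \<le> qmass V q f"
            using F F' f by (intro Lq_finite_sum_le) auto
          finally show ?thesis
            using F(3) unfolding dist_real_def by linarith
        qed
        also have "(\<Sum>v\<in>F. cmod (g v - f v) powr q) \<le> (\<Sum>v\<in>F. d powr q)"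
          using c q by (intro sum_mono powr_mono2) (auto simp: g less_imp_le)
        also have "\<dots> = card F * (e / (4 * (card F + 1)))"
          using q e by (simp add: d_def powr_powr)
        also have "\<dots> \<le> e / 4"
          using e by (simp add: field_simps)
        finally show "(\<Sum>v\<in>F'. cmod (g v - f v) powr q) \<le> e / 2"
          by simp
      qed (use f Lq_iff F in \<open>auto simp: g\<close>)
      ultimately show ?thesis
        using e by (intro bexI[of _ g]) auto
    qed
  qed
qed

end

section \<open>The backward shift\<close>

locale bounded_tree_shift = rooted_leafless_tree V E r + unit_weight V q lam
  for V :: "'a set" and E r q lam +
  assumes bounded: "bounded_operator_on (Lq V q lam) (Lq_norm V q lam) (backward_shift V E)"
begin

section \<open>Growth of the iterates\<close>

lemma funpow_in_Lq: "f \<in> Lq V q lam \<Longrightarrow> (backward_shift V E ^^ n) f \<in> Lq V q lam"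
  using bounded by (induction n) (auto simp: bounded_operator_on_def)

lemma qmass_funpow_le:
  obtains D where "D \<ge> 1"
    "\<And>f n. f \<in> Lq V q lam \<Longrightarrow> qmass V q ((backward_shift V E ^^ n) f) \<le> D ^ n * qmass V q f"
proof -
  obtain C where C: "\<And>f. f \<in> Lq V q lam \<Longrightarrow> Lq_norm V q lam (backward_shift V E f) \<le> C * Lq_norm V q lam f"
    using bounded unfolding bounded_operator_on_def by blast
  \<comment> \<open>The maximum with 1 makes \<open>D ^ n\<close> positive and nondecreasing in
    \<open>n\<close>, whatever the sign and size of \<open>C\<close>.\<close>
  define D where "D = max 1 C powr q"
  have D: "D \<ge> 1"
    using q by (auto simp: D_def intro: ge_one_powr_ge_zero)
  have step: "qmass V q (backward_shift V E f) \<le> D * qmass V q f" if "f \<in> Lq V q lam" for f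
  proof -
    have nonneg: "Lq_norm V q lam h \<ge> 0" for h
      by (simp add: Lq_norm_def)
    have "Lq_norm V q lam (backward_shift V E f) \<le> max 1 C * Lq_norm V q lam f"
      using C[OF that] nonneg[of f] by (meson max.cobounded2 mult_right_mono order_trans)
    then have "Lq_norm V q lam (backward_shift V E f) powr q \<le> (max 1 C * Lq_norm V q lam f) powr q"
      using q nonneg by (intro powr_mono2) auto
    then show ?thesis
      using nonneg by (simp add: qmass_eq D_def powr_mult)
  qed
  show ?thesis
  proof (rule that[OF D])
    fix f n assume f: "f \<in> Lq V q lam"
    show "qmass V q ((backward_shift V E ^^ n) f) \<le> D ^ n * qmass V q f"
    proof (induction n)
      case (Suc n)
      have "qmass V q ((backward_shift V E ^^ Suc n) f) \<le> D * qmass V q ((backward_shift V E ^^ n) f)"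
        using step[OF funpow_in_Lq[OF f]] by simp
      also have "\<dots> \<le> D * (D ^ n * qmass V q f)"
        using Suc D by (intro mult_left_mono) auto
      finally show ?case
        by (simp add: mult.assoc)
    qed auto
  qed
qed

section \<open>Free ends exclude hypercyclicity\<close>

lemma not_hypercyclic_if_free_end:
  assumes "has_free_end V E"
  shows "\<not> hypercyclic_on (Lq V q lam) (Lq_norm V q lam) (backward_shift V E)"
proof
  assume "hypercyclic_on (Lq V q lam) (Lq_norm V q lam) (backward_shift V E)"
  then obtain f where f: "f \<in> Lq V q lam"
    and dense: "dense_in (Lq V q lam) (Lq_norm V q lam) {(backward_shift V E ^^ n) f | n. True}"
    unfolding hypercyclic_on_def by blast
  obtain u where u: "u \<in> V" "\<And>v. descendant V E u v \<Longrightarrow> outdegree E v = 1"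
    using assms unfolding has_free_end_def by blast
  \<comment> \<open>The vertex \<open>u\<close> itself may branch; its child \<open>v\<close> is a
    descendant, so every generation below \<open>v\<close> is a singleton.\<close>
  obtain v where v: "(u, v) \<in> E"
    using outdegree_pos[OF u(1)] unfolding outdegree_def
    by (metis Collect_empty_eq card.empty not_one_le_zero)
  then have "v \<in> V"
    using edge_in_V by blast
  have card1: "card (gen n v) = 1" for n
  proof (induction n)
    case (Suc n)
    have "card (gen (Suc n) v) = (\<Sum>w\<in>gen n v. 1)"
      unfolding card_gen_Suc using u(2) descendantI[OF v] by (intro sum.cong) auto
    then show ?case
      using Suc by simp
  qed (simp add: Image_singleton)
  define M where "M = Lq_norm V q lam f"
  have orbit: "cmod ((backward_shift V E ^^ n) f v) \<le> M" for n
  proof -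
    obtain w where w: "gen n v = {w}"
      using card1 card_1_singletonE by blast
    then have "w \<in> V"
      using relpow_in_V \<open>v \<in> V\<close> by blast
    then show ?thesis
      unfolding backward_shift_funpow w M_def using Lq_norm_ge_value[OF f] by simp
  qed
  \<comment> \<open>At \<open>v\<close> this exceeds the bound \<open>M\<close> on the orbit by 2,
    more than the tolerance 1 used below.\<close>
  define g where "g = (\<lambda>w. if w = v then complex_of_real (M + 2) else 0)"
  have "g \<in> Lq V q lam"
    using Lq_finite_support[of "{v}" g] \<open>v \<in> V\<close> by (auto simp: g_def)
  then obtain n where n: "Lq_norm V q lam (\<lambda>w. (backward_shift V E ^^ n) f w - g w) < 1"
    using dense zero_less_one unfolding dense_in_def by blast
  have "(\<lambda>w. - g w) \<in> Lq V q lam"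
    using Lq_finite_support[of "{v}" "\<lambda>w. - g w"] \<open>v \<in> V\<close> by (auto simp: g_def)
  then have "(\<lambda>w. (backward_shift V E ^^ n) f w - g w) \<in> Lq V q lam"
    using Lq_add[OF funpow_in_Lq[OF f, of n]] by fastforce
  from Lq_norm_ge_value[OF this \<open>v \<in> V\<close>] n
  have "cmod ((backward_shift V E ^^ n) f v - complex_of_real (M + 2)) < 1"
    by (simp add: g_def)
  then have "cmod (complex_of_real (M + 2)) < M + 1"
    using orbit[of n] norm_triangle_ineq2[of "complex_of_real (M + 2)" "(backward_shift V E ^^ n) f v"]
    by (simp add: norm_minus_commute)
  then show False
    unfolding norm_of_real by linarith
qed

text \<open>A generation of size \<open>N\<close> carries \<open>N\<close> equal values of modulus
  \<open>cmod (g u) / N\<close>, and generations below distinct vertices are disjoint.\<close>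

lemma spread_Lq:
  assumes "finite {u. g u \<noteq> 0}" "{u. g u \<noteq> 0} \<subseteq> V"
  shows "spread n g \<in> Lq V q lam \<and> qmass V q (spread n g)
    \<le> (\<Sum>u | g u \<noteq> 0. cmod (g u) powr q * real (card (gen n u)) powr (1 - q))"
proof -
  define F where "F = {u. g u \<noteq> 0}"
  have F: "finite F" "F \<subseteq> V"
    using assms by (auto simp: F_def)
  define H where "H = (\<Union>u\<in>F. gen n u)"
  have H: "finite H" "H \<subseteq> V" "\<And>v. v \<notin> H \<Longrightarrow> spread n g v = 0"
    unfolding H_def using F finite_gen relpow_in_V
    by (blast, blast) (auto simp: F_def elim: spread_nonzeroE)
  have "(\<Sum>v\<in>H. cmod (spread n g v) powr q) = (\<Sum>u\<in>F. \<Sum>v\<in>gen n u. cmod (spread n g v) powr q)"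
    unfolding H_def using F finite_gen unique_ancestor by (intro sum.UNION_disjoint) blast+
  also have "\<dots> = (\<Sum>u\<in>F. cmod (g u) powr q * real (card (gen n u)) powr (1 - q))"
  proof (rule sum.cong[OF refl])
    fix u assume "u \<in> F"
    then have c: "real (card (gen n u)) > 0"
      using card_gen_pos[of u n] F by auto
    have "(\<Sum>v\<in>gen n u. cmod (spread n g v) powr q)
      = (\<Sum>v\<in>gen n u. (cmod (g u) / real (card (gen n u))) powr q)"
      by (intro sum.cong) (auto simp: spread_gen norm_divide)
    also have "\<dots> = real (card (gen n u)) * (cmod (g u) / real (card (gen n u))) powr q"
      by simp
    also have "\<dots> = cmod (g u) powr q * real (card (gen n u)) powr (1 - q)"
      using c by (simp add: powr_divide powr_diff)
    finally show "(\<Sum>v\<in>gen n u. cmod (spread n g v) powr q)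
      = cmod (g u) powr q * real (card (gen n u)) powr (1 - q)" .
  qed
  finally show ?thesis
    using Lq_finite_support[of H "spread n g", OF H] by (simp add: F_def)
qed

lemma qmass_spread_eventually_less:
  assumes "\<not> has_free_end V E" "finite {u. g u \<noteq> 0}" "{u. g u \<noteq> 0} \<subseteq> V" "e > 0"
  shows "\<forall>\<^sub>F n in sequentially. qmass V q (spread n g) < e"
proof -
  have "((\<lambda>n. \<Sum>u | g u \<noteq> 0. cmod (g u) powr q * real (card (gen n u)) powr (1 - q)) \<longlongrightarrow> 0) sequentially"
    using assms q card_gen_at_top
    by (intro tendsto_null_sum tendsto_mult_right_zero tendsto_neg_powr) auto
  from order_tendstoD(2)[OF this \<open>e > 0\<close>] show ?thesis
    by (rule eventually_mono) (use spread_Lq[OF assms(2,3)] in \<open>meson le_less_trans\<close>)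
qed

section \<open>Construction of a hypercyclic vector\<close>

lemma hypercyclic_if_no_free_end:
  assumes "\<not> has_free_end V E"
  shows "hypercyclic_on (Lq V q lam) (Lq_norm V q lam) (backward_shift V E)"
proof -
  obtain D where D: "D \<ge> 1"
    "\<And>f n. f \<in> Lq V q lam \<Longrightarrow> qmass V q ((backward_shift V E ^^ n) f) \<le> D ^ n * qmass V q f"
    using qmass_funpow_le by blast
  obtain G where G: "countable G" "G \<noteq> {}"
    "\<And>g. g \<in> G \<Longrightarrow> finite {v. g v \<noteq> 0} \<and> {v. g v \<noteq> 0} \<subseteq> V"
    "\<And>f e. f \<in> Lq V q lam \<Longrightarrow> e > 0 \<Longrightarrow>
      \<exists>g\<in>G. (\<lambda>v. g v - f v) \<in> Lq V q lam \<and> qmass V q (\<lambda>v. g v - f v) < e"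
    using Lq_countable_dense[OF countable_V] by blast
  \<comment> \<open>The pairing makes every element of \<open>G\<close> occur infinitely often.\<close>
  define g where "g k = from_nat_into G (fst (prod_decode k))" for k
  have g: "finite {v. g k v \<noteq> 0}" "{v. g k v \<noteq> 0} \<subseteq> V" for k
    using G(3) from_nat_into[OF G(2)] by (auto simp: g_def)
  \<comment> \<open>A strict bound on the depth of the support of \<open>g k\<close>. The inserted 0
    covers \<open>g k = 0\<close>, and \<open>Suc\<close> makes the powers \<open>n k\<close>
    strictly increasing.\<close>
  define b where "b k = Suc (Max (insert 0 (depth ` {v. g k v \<noteq> 0})))" for k
  have b: "depth v < b k" if "g k v \<noteq> 0" for k v
    using that g[of k] by (auto simp: b_def less_Suc_eq_le intro: Max_ge)
  \<comment> \<open>Dividing by \<open>D ^ n k\<close> keeps the next piece small even after the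
    earlier iterate of order \<open>n k\<close> has amplified it. \<open>True\<close> is the trivial
    invariant of the recursive choice, and \<open>n 0\<close> is arbitrary.\<close>
  have "\<exists>n. \<forall>k. True \<and> b k + n k \<le> n (Suc k) \<and>
    qmass V q (spread (n (Suc k)) (g (Suc k))) \<le> (1/2) ^ Suc k / D ^ n k"
  proof (rule dependent_nat_choice)
    fix m k
    have "\<forall>\<^sub>F n in sequentially. qmass V q (spread n (g (Suc k))) < (1/2) ^ Suc k / D ^ m"
      using D by (intro qmass_spread_eventually_less assms g) auto
    moreover have "\<forall>\<^sub>F n in sequentially. b k + m \<le> n"
      by (rule eventually_ge_at_top)
    ultimately have "\<forall>\<^sub>F n in sequentially. True \<and> b k + m \<le> n \<and>
      qmass V q (spread n (g (Suc k))) \<le> (1/2) ^ Suc k / D ^ m"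
      by eventually_elim auto
    then show "\<exists>n. True \<and> b k + m \<le> n \<and>
      qmass V q (spread n (g (Suc k))) \<le> (1/2) ^ Suc k / D ^ m"
      by (rule eventually_happens'[OF sequentially_bot])
  qed auto
  then obtain n where n: "\<And>k. b k + n k \<le> n (Suc k)"
    "\<And>k. qmass V q (spread (n (Suc k)) (g (Suc k))) \<le> (1/2) ^ Suc k / D ^ n k"
    by blast
  have "n k < n (Suc k)" for k
    using n(1)[of k] by (simp add: b_def)
  then have mono: "strict_mono n"
    by (simp add: strict_mono_Suc_iff)
  define h where "h k = spread (n k) (g k)" for k
  have h: "h k \<in> Lq V q lam" for k
    using spread_Lq g by (simp add: h_def)
  have h_depth: "v \<in> V \<and> n k \<le> depth v \<and> depth v < n (Suc k)" if nz: "h k v \<noteq> 0" for k v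
  proof -
    obtain u where u: "(u, v) \<in> E ^^ n k" "g k u \<noteq> 0"
      using nz unfolding h_def by (rule spread_nonzeroE)
    then have "u \<in> V"
      using g by blast
    then show ?thesis
      using depth_relpow[OF u(1)] relpow_in_V[OF u(1)] b[OF u(2)] n(1)[of k] by auto
  qed
  \<comment> \<open>The depth range containing \<open>d\<close>. Depths below \<open>n 0\<close>
    also get index 0, which is harmless because \<open>h 0\<close> vanishes there.\<close>
  define idx where "idx d = (LEAST j. d < n (Suc j))" for d
  have idx: "d < n (Suc (idx d))" for d
    unfolding idx_def by (rule LeastI[of _ d]) (use strict_mono_imp_increasing[OF mono, of "Suc d"] in simp)
  have idx_eq: "idx d = k" if "n k \<le> d" "d < n (Suc k)" for d k
  proof (rule antisym)
    show "idx d \<le> k"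
      unfolding idx_def using that by (intro Least_le)
    show "k \<le> idx d"
      using that idx[of d] strict_mono_less[OF mono] by (metis le_less_trans less_Suc_eq_le)
  qed
  \<comment> \<open>All pieces after the \<open>k\<close>-th, glued by depth.\<close>
  define tail where "tail k v = (if v \<in> V \<and> n (Suc k) \<le> depth v then h (idx (depth v)) v else 0)" for k v
  \<comment> \<open>The piece \<open>h 0\<close> is kept apart because the choice of
    \<open>n\<close> gives no smallness bound for it.\<close>
  define f where "f v = h 0 v + tail 0 v" for v
  have tail: "tail k \<in> Lq V q lam \<and> qmass V q (tail k) \<le> (1/2) ^ k / D ^ n k" for k
  proof (rule Lq_piecewise[where I = "{k<..}" and h = h])
    fix J :: "nat set" assume J: "finite J" "J \<subseteq> {k<..}"
    obtain K where K: "J \<subseteq> {..<K}"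
      using J(1) finite_nat_iff_bounded by blast
    have "(\<Sum>j\<in>J. qmass V q (h j)) \<le> (\<Sum>j\<in>J. (1/2) ^ j / D ^ n k)"
    proof (rule sum_mono)
      fix j assume "j \<in> J"
      \<comment> \<open>The bound for piece \<open>Suc i\<close> involves \<open>n i\<close>, and
        \<open>n i \<ge> n k\<close>; so one denominator serves all later pieces and a geometric sum
        remains.\<close>
      then obtain i where i: "j = Suc i" "i \<ge> k"
        using J by (cases j) auto
      have "qmass V q (h j) \<le> (1/2) ^ j / D ^ n i"
        using n(2)[of i] i by (simp add: h_def)
      also have "\<dots> \<le> (1/2) ^ j / D ^ n k"
        using D i strict_mono_less_eq[OF mono]
        by (intro divide_left_mono power_increasing) auto
      finally show "qmass V q (h j) \<le> (1/2) ^ j / D ^ n k" .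
    qed
    also have "\<dots> = (\<Sum>j\<in>J. (1/2) ^ j) / D ^ n k"
      by (simp add: sum_divide_distrib)
    also have "\<dots> \<le> (1/2) ^ k / D ^ n k"
    proof (rule divide_right_mono)
      have "(\<Sum>j\<in>J. (1/2::real) ^ j) \<le> (\<Sum>j\<in>{Suc k..<Suc k + K}. (1/2) ^ j)"
        using J K by (intro sum_mono2) (auto dest!: subsetD)
      also have "\<dots> = (1/2) ^ k - (1/2) ^ (k + K)"
        by (induction K) auto
      also have "\<dots> \<le> (1/2) ^ k"
        by simp
      finally show "(\<Sum>j\<in>J. (1/2::real) ^ j) \<le> (1/2) ^ k" .
    qed (use D in simp)
    finally show "(\<Sum>j\<in>J. qmass V q (h j)) \<le> (1/2) ^ k / D ^ n k" .
  next
    fix v assume "tail k v \<noteq> 0"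
    then have v: "n (Suc k) \<le> depth v" "tail k v = h (idx (depth v)) v"
      by (auto simp: tail_def split: if_splits)
    have "k < idx (depth v)"
      using v(1) idx[of "depth v"] strict_mono_less[OF mono] by (metis Suc_less_SucD le_less_trans)
    then show "\<exists>j\<in>{k<..}. tail k v = h j v"
      using v by auto
  qed (auto simp: h tail_def)
  have f: "f \<in> Lq V q lam"
    unfolding f_def using Lq_add[of "h 0" "tail 0"] h tail by blast
  have f_eq: "f v = h (idx (depth v)) v" if "v \<in> V" for v
  proof (cases "depth v < n 1")
    case True
    then have "idx (depth v) = 0"
      unfolding idx_def by (intro Least_equality) auto
    with True show ?thesis
      by (simp add: f_def tail_def)
  next
    case False
    then have "h 0 v = 0"
      using h_depth[of 0 v] by auto
    with False that show ?thesis
      by (simp add: f_def tail_def)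
  qed
  have f_split: "f v = h k v + tail k v" if "v \<in> V" "n k \<le> depth v" for k v
  proof (cases "depth v < n (Suc k)")
    case True
    then show ?thesis
      using that f_eq idx_eq by (simp add: tail_def)
  next
    case False
    then have "h k v = 0"
      using h_depth by blast
    with False that f_eq show ?thesis
      by (simp add: tail_def)
  qed
  have shift: "(backward_shift V E ^^ n k) f u = g k u + (backward_shift V E ^^ n k) (tail k) u" for k u
  proof (cases "u \<in> V")
    case True
    \<comment> \<open>This generation has depth \<open>depth u + n k\<close>, which is beyond the
      ranges of all earlier pieces.\<close>
    have "(\<Sum>v\<in>gen (n k) u. f v) = (\<Sum>v\<in>gen (n k) u. h k v + tail k v)"
      using True depth_relpow relpow_in_V by (intro sum.cong f_split) auto
    then show ?thesis
      unfolding backward_shift_funpow sum.distrib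
      using sum_gen_spread[OF True] by (simp add: h_def)
  next
    case False
    then have "g k u = 0"
      using g by blast
    moreover have "(backward_shift V E ^^ n k) f u = 0" "(backward_shift V E ^^ n k) (tail k) u = 0"
      using funpow_in_Lq f tail False Lq_iff by blast+
    ultimately show ?thesis
      by simp
  qed
  have "\<exists>m. Lq_norm V q lam (\<lambda>v. (backward_shift V E ^^ m) f v - x v) < e"
    if x: "x \<in> Lq V q lam" and e: "e > 0" for x e
  proof -
    \<comment> \<open>Two errors below \<open>d\<close>, combined by \<open>Lq_add\<close>, stay
      below \<open>e powr q\<close>.\<close>
    define d where "d = e powr q / (2 * 2 powr q)"
    have d: "d > 0"
      using e by (simp add: d_def)
    obtain y where y: "y \<in> G" "(\<lambda>v. y v - x v) \<in> Lq V q lam" "qmass V q (\<lambda>v. y v - x v) < d"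
      using G(4)[OF x d] by blast
    obtain i where i: "from_nat_into G i = y"
      using from_nat_into_surj[OF G(1) y(1)] by blast
    obtain m where m: "(1/2::real) ^ m < d"
      using real_arch_pow_inv[OF d, of "1/2"] by auto
    \<comment> \<open>This index selects the target \<open>y\<close> and satisfies
      \<open>k \<ge> m\<close>, so that \<open>(1/2) ^ k\<close> is below \<open>d\<close> as
      well.\<close>
    define k where "k = prod_encode (i, m)"
    have "g k = y"
      using i by (simp add: g_def k_def)
    define t where "t = (backward_shift V E ^^ n k) (tail k)"
    have t: "t \<in> Lq V q lam"
      using tail funpow_in_Lq by (simp add: t_def)
    have "qmass V q t \<le> D ^ n k * qmass V q (tail k)"
      unfolding t_def using D(2) tail by blast
    also have "\<dots> \<le> D ^ n k * ((1/2) ^ k / D ^ n k)"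
      using tail D by (intro mult_left_mono) auto
    also have "\<dots> = (1/2) ^ k"
      using D by simp
    also have "\<dots> \<le> (1/2) ^ m"
      using le_prod_encode_2[of m i] by (intro power_decreasing) (auto simp: k_def)
    finally have "qmass V q t < d"
      using m by linarith
    have "qmass V q (\<lambda>v. t v + (y v - x v)) \<le> 2 powr q * (qmass V q t + qmass V q (\<lambda>v. y v - x v))"
      using Lq_add[OF t y(2)] by blast
    also have "\<dots> < 2 powr q * (d + d)"
      using \<open>qmass V q t < d\<close> y(3) by (intro mult_strict_left_mono) auto
    also have "\<dots> = e powr q"
      by (simp add: d_def)
    also have "(\<lambda>v. t v + (y v - x v)) = (\<lambda>v. (backward_shift V E ^^ n k) f v - x v)"
      by (simp add: shift t_def \<open>g k = y\<close> algebra_simps)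
    finally show ?thesis
      using Lq_norm_less e by blast
  qed
  then have "dense_in (Lq V q lam) (Lq_norm V q lam) {(backward_shift V E ^^ n) f | n. True}"
    unfolding dense_in_def using funpow_in_Lq[OF f] by blast
  with f show ?thesis
    unfolding hypercyclic_on_def by blast
qed

end

theorem corollary5p6:
  fixes V :: "'a set" and E :: "('a \<times> 'a) set" and q :: real and lam :: "'a \<Rightarrow> real"
  assumes tree: "directed_tree V E"
    and leafless: "leafless V E"
    and root: "\<exists>r. is_root V E r"
    and q: "1 < q"
    and lam: "\<And>v. v \<in> V \<Longrightarrow> lam v = 1"
    and bounded: "bounded_operator_on (Lq V q lam) (Lq_norm V q lam) (backward_shift V E)"
  shows "hypercyclic_on (Lq V q lam) (Lq_norm V q lam) (backward_shift V E)
           \<longleftrightarrow> \<not> has_free_end V E"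
proof -
  obtain r where "is_root V E r"
    using root by blast
  then interpret bounded_tree_shift V E r q lam
    using assms
    by (auto simp: bounded_tree_shift_def rooted_leafless_tree_def rooted_leafless_tree_axioms_def
        unit_weight_def bounded_tree_shift_axioms_def)
  show ?thesis
    using hypercyclic_if_no_free_end not_hypercyclic_if_free_end by blast
qed

end
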